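(* Let $A$ be an algebra and let $\alpha,\beta\in\operatorname{Con}A$. Then (1) $C(\operatorname{Ug}\{\alpha\},\operatorname{Ug}\{\beta\})=\operatorname{Ug}\{C(\alpha,\beta)\}$; (2) $\tilde C(\operatorname{Ug}\{\alpha\},\operatorname{Ug}\{\beta\})=\operatorname{Ug}\{\tilde C(\alpha,\beta)\}$.
   Context: Algebras are algebras of universal algebra with finitary operations (the underlying set may be empty); terms are terms in the signature of $A$. A uniformity on a set $S$ is a filter $\mathcal U$ of binary relations on $S$ (nonempty, closed upward and under finite intersection) such that every $U\in\mathcal U$ is reflexive, $U\in\mathcal U$ implies $U^{-1}\in\mathcal U$, and for each $U\in\mathcal U$ there is $V\in\mathcal U$ with $V\circ V\subseteq U$. A uniformity $\mathcal U$ on an algebra $A$ is compatible if for each basic operation $\omega$ and $U\in\mathcal U$ there is $\bar U\in\mathcal U$ such that $x_i\mathrel{\bar U}y_i$ for all $i$ implies $\omega(\mathbf x)\mathrel U\omega(\mathbf y)$. $\operatorname{Unif}A$ is the set of compatible uniformities on $A$, ordered by reverse inclusion ($\mathcal U\le\mathcal V$ iff $\mathcal V\subseteq\mathcal U$); it is a complete lattice. For a congruence $\alpha$, $\operatorname{Ug}\{\alpha\}=\{U\subseteq A^2: \alpha\subseteq U\}$, a compatible uniformity. For binary relations $U,V$ on $A$, $n,n'\ge0$ and an $(n+n')$-ary term $t$, $\mathrm M_{n,n',t}(U,V)$ is the set of $2\times2$ matrices $\begin{pmatrix}t(\mathbf a,\mathbf b)&t(\mathbf a,\mathbf c)\\t(\mathbf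 a',\mathbf b)&t(\mathbf a',\mathbf c)\end{pmatrix}$ with $\mathbf a,\mathbf a'\in A^n$, $\mathbf b,\mathbf c\in A^{n'}$, $a_i\mathrel Ua_i'$ for all $i$ and $b_j\mathrel Vc_j$ for all $j$. Matrices are written $(u_{ij})$. Congruences: $C(\alpha,\beta)$ is the least congruence $\delta$ such that for all $n,n',t$, $(u_{ij})\in\mathrm M_{n,n',t}(\alpha,\beta)$ and $u_{11}\mathrel\delta u_{12}$ imply $u_{21}\mathrel\delta u_{22}$. $\tilde C(\alpha,\beta)$ is the least congruence $\delta$ such that for all $n,n',t$, $(u_{ij})\in\mathrm M_{n,n',t}(\alpha,\beta)$ and $u_{11}=u_{12}$ imply $u_{21}\mathrel\delta u_{22}$. Uniformities: for $\mathcal U,\mathcal V\in\operatorname{Unif}A$, $C(\mathcal U,\mathcal V)$ is the least $\mathcal W\in\operatorname{Unif}A$ such that for all $n,n',t$ and $W\in\mathcal W$ there are $U\in\mathcal U$, $V\in\mathcal V$, $\bar W\in\mathcal W$ such that $(u_{ij})\in\mathrm M_{n,n',t}(U,V)$ and $u_{11}\mathrel{\bar W}u_{12}$ imply $u_{21}\mathrel Wu_{22}$. $\tilde C(\mathcal U,\mathcal V)$ is the least $\mathcal W\in\operatorname{Unif}A$ such that for all $n,n',t$ and $W\in\mathcal W$ there are $U\in\mathcal U$, $V\in\mathcal V$ such that $(u_{ij})\in\mathrm M_{n,n',t}(U,V)$ and $u_{11}=u_{12}$ imply $u_{21}\mathrel Wu_{22}$. All these least elements exist. *)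

theory Defs
  imports Main
begin

section \<open>Universal algebras and terms\<close>

text \<open>
  The operation symbols form a set rather than a whole type, so that the signature may be
  empty. The carrier may be empty too.
\<close>

record ('f, 'a) ualg =
  carrier :: "'a set"
  symbols :: "'f set"
  arity :: "'f \<Rightarrow> nat"
  interp :: "'f \<Rightarrow> 'a list \<Rightarrow> 'a"

definition tuples :: "'a set \<Rightarrow> nat \<Rightarrow> 'a list set" where
  "tuples S n = {xs. length xs = n \<and> set xs \<subseteq> S}"

definition universal_algebra :: "('f, 'a) ualg \<Rightarrow> bool" where
  "universal_algebra A \<longleftrightarrow>
     (\<forall>f\<in>symbols A. \<forall>xs\<in>tuples (carrier A) (arity A f). interp A f xs \<in> carrier A)"

datatype 'f uterm = Var nat | App 'f "'f uterm list"

primrec is_term :: "('f, 'a) ualg \<Rightarrow> nat \<Rightarrow> 'f uterm \<Rightarrow> bool" where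
  "is_term A n (Var i) \<longleftrightarrow> i < n"
| "is_term A n (App f ts) \<longleftrightarrow>
     f \<in> symbols A \<and> length ts = arity A f \<and> list_all (is_term A n) ts"

primrec eval_term :: "('f, 'a) ualg \<Rightarrow> 'f uterm \<Rightarrow> 'a list \<Rightarrow> 'a" where
  "eval_term A (Var i) xs = xs ! i"
| "eval_term A (App f ts) xs = interp A f (map (\<lambda>t. eval_term A t xs) ts)"

section \<open>Congruences and compatible uniformities\<close>

definition Con :: "('f, 'a) ualg \<Rightarrow> 'a rel set" where
  "Con A = {\<theta>. equiv (carrier A) \<theta> \<and>
     (\<forall>f\<in>symbols A. \<forall>xs\<in>tuples (carrier A) (arity A f). \<forall>ys\<in>tuples (carrier A) (arity A f).
        list_all2 (\<lambda>x y. (x, y) \<in> \<theta>) xs ys \<longrightarrow> (interp A f xs, interp A f ys) \<in> \<theta>)}"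

text \<open>The improper filter is only excluded by reflexivity; on the empty set it is a uniformity.\<close>

definition uniformity_on :: "'a set \<Rightarrow> 'a rel set \<Rightarrow> bool" where
  "uniformity_on S \<U> \<longleftrightarrow>
     \<U> \<subseteq> Pow (S \<times> S) \<and>
     \<U> \<noteq> {} \<and>
     (\<forall>U\<in>\<U>. \<forall>V. U \<subseteq> V \<and> V \<subseteq> S \<times> S \<longrightarrow> V \<in> \<U>) \<and>
     (\<forall>U\<in>\<U>. \<forall>V\<in>\<U>. U \<inter> V \<in> \<U>) \<and>
     (\<forall>U\<in>\<U>. refl_on S U) \<and>
     (\<forall>U\<in>\<U>. U\<inverse> \<in> \<U>) \<and>
     (\<forall>U\<in>\<U>. \<exists>V\<in>\<U>. V O V \<subseteq> U)"

definition compatible :: "('f, 'a) ualg \<Rightarrow> 'a rel set \<Rightarrow> bool" where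
  "compatible A \<U> \<longleftrightarrow>
     (\<forall>f\<in>symbols A. \<forall>U\<in>\<U>. \<exists>U'\<in>\<U>.
        \<forall>xs\<in>tuples (carrier A) (arity A f). \<forall>ys\<in>tuples (carrier A) (arity A f).
          list_all2 (\<lambda>x y. (x, y) \<in> U') xs ys \<longrightarrow> (interp A f xs, interp A f ys) \<in> U)"

definition Unif :: "('f, 'a) ualg \<Rightarrow> 'a rel set set" where
  "Unif A = {\<U>. uniformity_on (carrier A) \<U> \<and> compatible A \<U>}"

text \<open>Uniformities are ordered by reverse inclusion.\<close>

definition unif_le :: "'a rel set \<Rightarrow> 'a rel set \<Rightarrow> bool" where
  "unif_le \<U> \<V> \<longleftrightarrow> \<V> \<subseteq> \<U>"

definition least_unif :: "('f, 'a) ualg \<Rightarrow> ('a rel set \<Rightarrow> bool) \<Rightarrow> 'a rel set" where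
  "least_unif A P = (THE \<W>. \<W> \<in> Unif A \<and> P \<W> \<and> (\<forall>\<W>'\<in>Unif A. P \<W>' \<longrightarrow> unif_le \<W> \<W>'))"

text \<open>\<open>Ug A \<alpha>\<close> is the uniformity usually written \<open>Ug {\<alpha>}\<close>.\<close>

definition Ug :: "('f, 'a) ualg \<Rightarrow> 'a rel \<Rightarrow> 'a rel set" where
  "Ug A \<alpha> = {U. U \<subseteq> carrier A \<times> carrier A \<and> \<alpha> \<subseteq> U}"

section \<open>Commutators\<close>

text \<open>A matrix is encoded by its rows, as \<open>((u11, u12), (u21, u22))\<close>.\<close>

definition M :: "('f, 'a) ualg \<Rightarrow> nat \<Rightarrow> nat \<Rightarrow> 'f uterm \<Rightarrow> 'a rel \<Rightarrow> 'a rel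
    \<Rightarrow> (('a \<times> 'a) \<times> ('a \<times> 'a)) set" where
  "M A n n' t U V =
     {((eval_term A t (a @ b), eval_term A t (a @ c)),
       (eval_term A t (a' @ b), eval_term A t (a' @ c))) | a a' b c.
        a \<in> tuples (carrier A) n \<and> a' \<in> tuples (carrier A) n \<and>
        b \<in> tuples (carrier A) n' \<and> c \<in> tuples (carrier A) n' \<and>
        list_all2 (\<lambda>x y. (x, y) \<in> U) a a' \<and> list_all2 (\<lambda>x y. (x, y) \<in> V) b c}"

definition C_con :: "('f, 'a) ualg \<Rightarrow> 'a rel \<Rightarrow> 'a rel \<Rightarrow> 'a rel" where
  "C_con A \<alpha> \<beta> = (LEAST \<delta>. \<delta> \<in> Con A \<and>
     (\<forall>n n' t. is_term A (n + n') t \<longrightarrow>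
        (\<forall>u11 u12 u21 u22. ((u11, u12), (u21, u22)) \<in> M A n n' t \<alpha> \<beta> \<longrightarrow>
           (u11, u12) \<in> \<delta> \<longrightarrow> (u21, u22) \<in> \<delta>)))"

definition Ctilde_con :: "('f, 'a) ualg \<Rightarrow> 'a rel \<Rightarrow> 'a rel \<Rightarrow> 'a rel" where
  "Ctilde_con A \<alpha> \<beta> = (LEAST \<delta>. \<delta> \<in> Con A \<and>
     (\<forall>n n' t. is_term A (n + n') t \<longrightarrow>
        (\<forall>u11 u12 u21 u22. ((u11, u12), (u21, u22)) \<in> M A n n' t \<alpha> \<beta> \<longrightarrow>
           u11 = u12 \<longrightarrow> (u21, u22) \<in> \<delta>)))"

definition C_unif :: "('f, 'a) ualg \<Rightarrow> 'a rel set \<Rightarrow> 'a rel set \<Rightarrow> 'a rel set" where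
  "C_unif A \<U> \<V> = least_unif A (\<lambda>\<W>.
     \<forall>n n' t. is_term A (n + n') t \<longrightarrow> (\<forall>W\<in>\<W>. \<exists>U\<in>\<U>. \<exists>V\<in>\<V>. \<exists>W'\<in>\<W>.
        \<forall>u11 u12 u21 u22. ((u11, u12), (u21, u22)) \<in> M A n n' t U V \<longrightarrow>
           (u11, u12) \<in> W' \<longrightarrow> (u21, u22) \<in> W))"

definition Ctilde_unif :: "('f, 'a) ualg \<Rightarrow> 'a rel set \<Rightarrow> 'a rel set \<Rightarrow> 'a rel set" where
  "Ctilde_unif A \<U> \<V> = least_unif A (\<lambda>\<W>.
     \<forall>n n' t. is_term A (n + n') t \<longrightarrow> (\<forall>W\<in>\<W>. \<exists>U\<in>\<U>. \<exists>V\<in>\<V>.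
        \<forall>u11 u12 u21 u22. ((u11, u12), (u21, u22)) \<in> M A n n' t U V \<longrightarrow>
           u11 = u12 \<longrightarrow> (u21, u22) \<in> W))"

end

theory Submission
  imports Defs
begin

text \<open>
  The intersection of a compatible uniformity \<open>\<W>\<close> is a congruence, and it inherits the
  centralizing condition for \<open>\<alpha>\<close>, \<open>\<beta>\<close> from that of \<open>\<W>\<close> for \<open>Ug {\<alpha>}\<close>, \<open>Ug {\<beta>}\<close>, because
  matrices over \<open>\<alpha>\<close>, \<open>\<beta>\<close> are matrices over every member of these filters. Hence the commutator
  congruence is contained in every member of \<open>\<W>\<close>, that is, \<open>\<W>\<close> is contained in the principal
  filter above that congruence, and this filter itself satisfies the condition.
\<close>

section \<open>Congruences and least congruences\<close>

lemma Con_subset: "\<theta> \<in> Con A \<Longrightarrow> \<theta> \<subseteq> carrier A \<times> carrier A"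
  by (auto simp: Con_def equiv_def)

text \<open>Guarantees that the families intersected below are nonempty.\<close>

lemma Con_full: "universal_algebra A \<Longrightarrow> carrier A \<times> carrier A \<in> Con A"
  by (auto simp: Con_def universal_algebra_def equiv_def refl_on_def sym_def trans_def)

text \<open>Nonemptiness matters: \<open>\<Inter>{}\<close> is the relation on the whole type, which
  may be larger than the square of the carrier.\<close>

lemma Con_Inter:
  assumes "D \<subseteq> Con A" "D \<noteq> {}"
  shows "\<Inter>D \<in> Con A"
proof -
  have eq: "equiv (carrier A) \<theta>" if "\<theta> \<in> D" for \<theta>
    using assms(1) that by (auto simp: Con_def)
  have "equiv (carrier A) (\<Inter>D)"
  proof (rule equivI)
    show "\<Inter>D \<subseteq> carrier A \<times> carrier A"
      using Con_subset assms by blast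
    show "refl_on (carrier A) (\<Inter>D)"
      using eq by (auto simp: equiv_def refl_on_def)
    show "sym (\<Inter>D)"
      using eq by (auto simp: equiv_def intro!: symI dest: symD)
    show "trans (\<Inter>D)"
      using eq unfolding equiv_def trans_def by blast
  qed
  moreover have "(interp A f xs, interp A f ys) \<in> \<Inter>D"
    if "f \<in> symbols A" "xs \<in> tuples (carrier A) (arity A f)" "ys \<in> tuples (carrier A) (arity A f)"
      "list_all2 (\<lambda>x y. (x, y) \<in> \<Inter>D) xs ys" for f xs ys
  proof
    fix \<theta> assume "\<theta> \<in> D"
    moreover from this have "list_all2 (\<lambda>x y. (x, y) \<in> \<theta>) xs ys"
      using that(4) by (auto elim: list_all2_mono)
    ultimately show "(interp A f xs, interp A f ys) \<in> \<theta>"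
      using that(1-3) assms(1) by (auto simp: Con_def)
  qed
  ultimately show ?thesis by (auto simp: Con_def)
qed

text \<open>\<open>LEAST\<close> says something only once a least element is exhibited; here it is
  the intersection of all congruences satisfying \<open>Q\<close>. The predicate \<open>Q\<close>
  stands for either of the two centralizing conditions, which allows both commutators to be treated
  at once.\<close>

lemma Least_Con:
  assumes "universal_algebra A" "Q (carrier A \<times> carrier A)"
    and "\<forall>D. (\<forall>\<theta>\<in>D. Q \<theta>) \<longrightarrow> Q (\<Inter>D)"
  shows Least_Con_in: "(LEAST \<delta>. \<delta> \<in> Con A \<and> Q \<delta>) \<in> Con A"
    and Least_Con_prop: "Q (LEAST \<delta>. \<delta> \<in> Con A \<and> Q \<delta>)"
    and Least_Con_subset: "\<And>\<theta>. \<lbrakk>\<theta> \<in> Con A; Q \<theta>\<rbrakk> \<Longrightarrow> (LEAST \<delta>. \<delta> \<in> Con A \<and> Q \<delta>) \<subseteq> \<theta>"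
proof -
  let ?D = "{\<delta>. \<delta> \<in> Con A \<and> Q \<delta>}"
  have ne: "?D \<noteq> {}"
    using Con_full[OF assms(1)] assms(2) by blast
  have Inter: "\<Inter>?D \<in> Con A" "Q (\<Inter>?D)"
    using ne assms(3) by (auto intro!: Con_Inter)
  have Least: "(LEAST \<delta>. \<delta> \<in> Con A \<and> Q \<delta>) = \<Inter>?D"
    by (rule Least_equality) (use Inter in auto)
  show "(LEAST \<delta>. \<delta> \<in> Con A \<and> Q \<delta>) \<in> Con A" "Q (LEAST \<delta>. \<delta> \<in> Con A \<and> Q \<delta>)"
    unfolding Least by (fact Inter)+
  show "\<And>\<theta>. \<lbrakk>\<theta> \<in> Con A; Q \<theta>\<rbrakk> \<Longrightarrow> (LEAST \<delta>. \<delta> \<in> Con A \<and> Q \<delta>) \<subseteq> \<theta>"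
    unfolding Least by blast
qed

section \<open>Terms and matrices\<close>

lemma eval_term_in_carrier:
  assumes "universal_algebra A" "is_term A n t" "xs \<in> tuples (carrier A) n"
  shows "eval_term A t xs \<in> carrier A"
  using assms(2)
proof (induction t)
  case (Var i)
  then show ?case using assms(3) by (auto simp: tuples_def)
next
  case (App f ts)
  then have "map (\<lambda>t. eval_term A t xs) ts \<in> tuples (carrier A) (arity A f)"
    by (auto simp: tuples_def list_all_iff)
  with App.prems show ?case
    using assms(1) by (simp add: universal_algebra_def)
qed

text \<open>Only the second row is recorded, because the centralizing conditions conclude something
  about that row alone. It follows that the full relation on the carrier satisfies both
  conditions.\<close>

lemma M_in_carrier:
  assumes "universal_algebra A" "is_term A (n + n') t"
    and "((u11, u12), (u21, u22)) \<in> M A n n' t U V"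
  shows "u21 \<in> carrier A" "u22 \<in> carrier A"
  using assms(3)
  by (auto simp: M_def tuples_def intro!: eval_term_in_carrier[OF assms(1,2)])

text \<open>\<open>U\<close> and \<open>V\<close> occur in the definition of \<open>M\<close> only
  positively, through \<open>list_all2\<close>.\<close>

lemma M_mono:
  fixes A :: "('f, 'a) ualg"
  assumes "U \<subseteq> U'" "V \<subseteq> V'"
  shows "M A n n' t U V \<subseteq> M A n n' t U' V'"
proof -
  have "list_all2 (\<lambda>x y. (x, y) \<in> R') xs ys"
    if "R \<subseteq> R'" "list_all2 (\<lambda>x y. (x, y) \<in> R) xs ys" for R R' :: "'a rel" and xs ys
    using that by (auto elim: list_all2_mono)
  from this[OF assms(1)] this[OF assms(2)] show ?thesis
    unfolding M_def by blast
qed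

section \<open>Compatible uniformities and their relation to congruences\<close>

lemma uniformity_onD:
  assumes "uniformity_on S \<U>"
  shows "\<U> \<noteq> {}"
    and "U \<in> \<U> \<Longrightarrow> U \<subseteq> S \<times> S"
    and "U \<in> \<U> \<Longrightarrow> refl_on S U"
    and "U \<in> \<U> \<Longrightarrow> U\<inverse> \<in> \<U>"
    and "U \<in> \<U> \<Longrightarrow> \<exists>V\<in>\<U>. V O V \<subseteq> U"
proof -
  note * = assms[unfolded uniformity_on_def]
  show "\<U> \<noteq> {}"
    and "U \<in> \<U> \<Longrightarrow> refl_on S U"
    and "U \<in> \<U> \<Longrightarrow> U\<inverse> \<in> \<U>"
    and "U \<in> \<U> \<Longrightarrow> \<exists>V\<in>\<U>. V O V \<subseteq> U"
    using * by simp_all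
  show "U \<in> \<U> \<Longrightarrow> U \<subseteq> S \<times> S"
    using conjunct1[OF *] by blast
qed

text \<open>\<open>\<theta>\<close> is itself the smallest member of the filter, so it serves as the
  witness in every existential axiom: \<open>\<theta> O \<theta> \<subseteq> \<theta>\<close> gives
  the square root of an entourage, and compatibility of \<open>\<theta>\<close> with the operations
  gives compatibility of the filter.\<close>

lemma Ug_in_Unif:
  assumes "\<theta> \<in> Con A"
  shows "Ug A \<theta> \<in> Unif A"
proof -
  have eq: "equiv (carrier A) \<theta>" and sub: "\<theta> \<subseteq> carrier A \<times> carrier A"
    using assms Con_subset by (auto simp: Con_def)
  then have comp: "\<theta> O \<theta> \<subseteq> \<theta>" and conv: "\<theta>\<inverse> = \<theta>" and refl: "refl_on (carrier A) \<theta>"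
    by (auto simp: equiv_def trans_O_subset sym_conv_converse_eq)
  have mem: "\<theta> \<in> Ug A \<theta>"
    using sub by (simp add: Ug_def)
  have "\<exists>V\<in>Ug A \<theta>. V O V \<subseteq> U" if "U \<in> Ug A \<theta>" for U
    using that comp by (intro bexI[OF _ mem]) (auto simp: Ug_def)
  moreover have "U\<inverse> \<in> Ug A \<theta>" if "U \<in> Ug A \<theta>" for U
    using that conv by (auto simp: Ug_def)
  moreover have "refl_on (carrier A) U" if "U \<in> Ug A \<theta>" for U
    using that refl by (auto simp: Ug_def refl_on_def)
  moreover have "Ug A \<theta> \<subseteq> Pow (carrier A \<times> carrier A)" "Ug A \<theta> \<noteq> {}"
    "\<forall>U\<in>Ug A \<theta>. \<forall>V. U \<subseteq> V \<and> V \<subseteq> carrier A \<times> carrier A \<longrightarrow> V \<in> Ug A \<theta>"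
    "\<forall>U\<in>Ug A \<theta>. \<forall>V\<in>Ug A \<theta>. U \<inter> V \<in> Ug A \<theta>"
    using mem unfolding Ug_def by blast+
  ultimately have "uniformity_on (carrier A) (Ug A \<theta>)"
    unfolding uniformity_on_def by simp
  moreover have "compatible A (Ug A \<theta>)"
    unfolding compatible_def
  proof (intro ballI)
    fix f U assume "f \<in> symbols A" "U \<in> Ug A \<theta>"
    then show "\<exists>U'\<in>Ug A \<theta>. \<forall>xs\<in>tuples (carrier A) (arity A f).
        \<forall>ys\<in>tuples (carrier A) (arity A f).
          list_all2 (\<lambda>x y. (x, y) \<in> U') xs ys \<longrightarrow> (interp A f xs, interp A f ys) \<in> U"
      using assms by (intro bexI[OF _ mem]) (auto simp: Con_def Ug_def)
  qed
  ultimately show ?thesis by (simp add: Unif_def)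
qed

text \<open>A pair in the intersection lies in every entourage, in particular in whichever smaller
  entourage an axiom supplies for a given \<open>W\<close>. The approximate laws of the uniformity
  thus become exact laws in the intersection.\<close>

lemma Inter_Unif_in_Con:
  assumes "\<W> \<in> Unif A"
  shows "\<Inter>\<W> \<in> Con A"
proof -
  have unif: "uniformity_on (carrier A) \<W>" and comp: "compatible A \<W>"
    using assms by (auto simp: Unif_def)
  have "equiv (carrier A) (\<Inter>\<W>)"
  proof (rule equivI)
    show "\<Inter>\<W> \<subseteq> carrier A \<times> carrier A"
      using uniformity_onD(1,2)[OF unif] by blast
    show "refl_on (carrier A) (\<Inter>\<W>)"
      using uniformity_onD(3)[OF unif] by (auto simp: refl_on_def)
    show "sym (\<Inter>\<W>)"
      using uniformity_onD(4)[OF unif] by (intro symI) blast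
    show "trans (\<Inter>\<W>)"
    proof (intro transI InterI)
      fix x y z W assume xy: "(x, y) \<in> \<Inter>\<W>" and yz: "(y, z) \<in> \<Inter>\<W>" and "W \<in> \<W>"
      \<comment> \<open>\<open>V\<close> depends on \<open>W\<close>, so transitivity is checked one
        entourage at a time; both given pairs lie in \<open>V\<close>.\<close>
      then obtain V where "V \<in> \<W>" "V O V \<subseteq> W"
        using uniformity_onD(5)[OF unif] by blast
      with xy yz show "(x, z) \<in> W" by blast
    qed
  qed
  moreover have "(interp A f xs, interp A f ys) \<in> \<Inter>\<W>"
    if prems: "f \<in> symbols A" "xs \<in> tuples (carrier A) (arity A f)" "ys \<in> tuples (carrier A) (arity A f)"
      "list_all2 (\<lambda>x y. (x, y) \<in> \<Inter>\<W>) xs ys" for f xs ys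
  proof
    fix W assume "W \<in> \<W>"
    then obtain W' where W': "W' \<in> \<W>"
      and *: "list_all2 (\<lambda>x y. (x, y) \<in> W') xs ys \<longrightarrow> (interp A f xs, interp A f ys) \<in> W"
      using comp prems(1-3) unfolding compatible_def by blast
    have "list_all2 (\<lambda>x y. (x, y) \<in> W') xs ys"
      using prems(4) W' by (auto elim: list_all2_mono)
    with * show "(interp A f xs, interp A f ys) \<in> W" by blast
  qed
  ultimately show ?thesis by (auto simp: Con_def)
qed

text \<open>The order is reverse inclusion, so the least uniformity is the largest filter. The last
  assumption says that every member of a competing \<open>\<W>\<close> contains
  \<open>\<delta>\<close>, that is, \<open>\<W> \<subseteq> Ug A \<delta>\<close>; antisymmetry of
  inclusion gives the uniqueness required by \<open>THE\<close>.\<close>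

lemma least_unif_Ug:
  assumes "\<delta> \<in> Con A" "P (Ug A \<delta>)"
    and "\<And>\<W>. \<lbrakk>\<W> \<in> Unif A; P \<W>\<rbrakk> \<Longrightarrow> \<delta> \<subseteq> \<Inter>\<W>"
  shows "least_unif A P = Ug A \<delta>"
proof -
  have "\<W> \<subseteq> Ug A \<delta>" if "\<W> \<in> Unif A" "P \<W>" for \<W>
    using assms(3)[OF that] that(1) by (auto simp: Unif_def Ug_def dest: uniformity_onD(2))
  then show ?thesis
    unfolding least_unif_def unif_le_def
    using assms(2) Ug_in_Unif[OF assms(1)] by (intro the_equality) blast+
qed

section \<open>Commutators of principal uniformities\<close>

theorem theorem4p9:
  fixes A :: "('f, 'a) ualg" and \<alpha> \<beta> :: "'a rel"
  assumes "universal_algebra A"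
    and "\<alpha> \<in> Con A" and "\<beta> \<in> Con A"
  shows "C_unif A (Ug A \<alpha>) (Ug A \<beta>) = Ug A (C_con A \<alpha> \<beta>) \<and>
         Ctilde_unif A (Ug A \<alpha>) (Ug A \<beta>) = Ug A (Ctilde_con A \<alpha> \<beta>)"
proof
  have Ug_self: "\<theta> \<in> Ug A \<theta>" if "\<theta> \<in> Con A" for \<theta>
    using Con_subset[OF that] by (simp add: Ug_def)
  have M_Ug: "m \<in> M A n n' t U V"
    if "U \<in> Ug A \<alpha>" "V \<in> Ug A \<beta>" "m \<in> M A n n' t \<alpha> \<beta>" for m n n' t U V
    using that M_mono[of \<alpha> U \<beta> V A n n' t] by (auto simp: Ug_def)

  define Q where "Q \<delta> \<longleftrightarrow> (\<forall>n n' t. is_term A (n + n') t \<longrightarrow>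
        (\<forall>u11 u12 u21 u22. ((u11, u12), (u21, u22)) \<in> M A n n' t \<alpha> \<beta> \<longrightarrow>
           (u11, u12) \<in> \<delta> \<longrightarrow> (u21, u22) \<in> \<delta>))" for \<delta>
  have Q_full: "Q (carrier A \<times> carrier A)"
    using M_in_carrier[OF assms(1)] unfolding Q_def by blast
  \<comment> \<open>If \<open>(u11, u12)\<close> lies in the intersection, it lies in each member,
    and each member then yields \<open>(u21, u22)\<close>.\<close>
  have Q_Inter: "\<forall>D. (\<forall>\<theta>\<in>D. Q \<theta>) \<longrightarrow> Q (\<Inter>D)"
    unfolding Q_def by blast
  \<comment> \<open>\<open>C(1)\<close>, \<open>C(2)\<close> and \<open>C(3)\<close> are membership
    in \<open>Con A\<close>, the centralizing condition and minimality of
    \<open>C_con A \<alpha> \<beta>\<close>.\<close>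
  note C = Least_Con[where Q = Q, OF assms(1) Q_full Q_Inter, unfolded Q_def, folded C_con_def]
  show "C_unif A (Ug A \<alpha>) (Ug A \<beta>) = Ug A (C_con A \<alpha> \<beta>)"
    unfolding C_unif_def
  proof (rule least_unif_Ug)
    show "C_con A \<alpha> \<beta> \<in> Con A" by (rule C(1))
    show "\<forall>n n' t. is_term A (n + n') t \<longrightarrow>
      (\<forall>W\<in>Ug A (C_con A \<alpha> \<beta>). \<exists>U\<in>Ug A \<alpha>. \<exists>V\<in>Ug A \<beta>. \<exists>W'\<in>Ug A (C_con A \<alpha> \<beta>).
        \<forall>u11 u12 u21 u22. ((u11, u12), (u21, u22)) \<in> M A n n' t U V \<longrightarrow>
           (u11, u12) \<in> W' \<longrightarrow> (u21, u22) \<in> W)"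
    proof (intro allI impI ballI)
      fix n n' t W assume "is_term A (n + n') t" "W \<in> Ug A (C_con A \<alpha> \<beta>)"
      then show "\<exists>U\<in>Ug A \<alpha>. \<exists>V\<in>Ug A \<beta>. \<exists>W'\<in>Ug A (C_con A \<alpha> \<beta>).
        \<forall>u11 u12 u21 u22. ((u11, u12), (u21, u22)) \<in> M A n n' t U V \<longrightarrow>
           (u11, u12) \<in> W' \<longrightarrow> (u21, u22) \<in> W"
        \<comment> \<open>The witnesses for \<open>U\<close>, \<open>V\<close>, \<open>W'\<close>
          are the generators \<open>\<alpha>\<close>, \<open>\<beta>\<close> and
          \<open>C_con A \<alpha> \<beta>\<close> of the three filters. The exact condition then
          puts \<open>(u21, u22)\<close> in the commutator congruence, which is contained in
          \<open>W\<close>.\<close>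
        using C(2) by (intro bexI[OF _ Ug_self] assms C(1)) (auto simp: Ug_def)
    qed
  next
    fix \<W> assume \<W>: "\<W> \<in> Unif A" and
      P: "\<forall>n n' t. is_term A (n + n') t \<longrightarrow>
        (\<forall>W\<in>\<W>. \<exists>U\<in>Ug A \<alpha>. \<exists>V\<in>Ug A \<beta>. \<exists>W'\<in>\<W>.
          \<forall>u11 u12 u21 u22. ((u11, u12), (u21, u22)) \<in> M A n n' t U V \<longrightarrow>
             (u11, u12) \<in> W' \<longrightarrow> (u21, u22) \<in> W)"
    show "C_con A \<alpha> \<beta> \<subseteq> \<Inter>\<W>"
    proof (rule C(3)[OF Inter_Unif_in_Con[OF \<W>]], intro allI impI InterI)
      fix n n' t u11 u12 u21 u22 W
      assume "is_term A (n + n') t" and M: "((u11, u12), u21, u22) \<in> M A n n' t \<alpha> \<beta>"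
        and u: "(u11, u12) \<in> \<Inter>\<W>" and "W \<in> \<W>"
      with P obtain U V W' where "U \<in> Ug A \<alpha>" "V \<in> Ug A \<beta>" "W' \<in> \<W>"
        and "((u11, u12), u21, u22) \<in> M A n n' t U V \<longrightarrow> (u11, u12) \<in> W' \<longrightarrow> (u21, u22) \<in> W"
        by meson
      \<comment> \<open>The matrix lies over \<open>U\<close> and \<open>V\<close> because these
        contain \<open>\<alpha>\<close> and \<open>\<beta>\<close>, and \<open>u\<close> puts its
        first row in \<open>W'\<close>, a member of \<open>\<W>\<close>.\<close>
      with M_Ug M u show "(u21, u22) \<in> W" by blast
    qed
  qed

  \<comment> \<open>The premise is now equality and does not involve \<open>\<delta>\<close>, so the
    condition passes to intersections through its conclusion alone.\<close>
  define R where "R \<delta> \<longleftrightarrow> (\<forall>n n' t. is_term A (n + n') t \<longrightarrow>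
        (\<forall>u11 u12 u21 u22. ((u11, u12), (u21, u22)) \<in> M A n n' t \<alpha> \<beta> \<longrightarrow>
           u11 = u12 \<longrightarrow> (u21, u22) \<in> \<delta>))" for \<delta>
  have R_full: "R (carrier A \<times> carrier A)"
    using M_in_carrier[OF assms(1)] unfolding R_def by blast
  have R_Inter: "\<forall>D. (\<forall>\<theta>\<in>D. R \<theta>) \<longrightarrow> R (\<Inter>D)"
    unfolding R_def by blast
  note Ct = Least_Con[where Q = R, OF assms(1) R_full R_Inter, unfolded R_def, folded Ctilde_con_def]
  show "Ctilde_unif A (Ug A \<alpha>) (Ug A \<beta>) = Ug A (Ctilde_con A \<alpha> \<beta>)"
    unfolding Ctilde_unif_def
  proof (rule least_unif_Ug)
    show "Ctilde_con A \<alpha> \<beta> \<in> Con A" by (rule Ct(1))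
    show "\<forall>n n' t. is_term A (n + n') t \<longrightarrow>
      (\<forall>W\<in>Ug A (Ctilde_con A \<alpha> \<beta>). \<exists>U\<in>Ug A \<alpha>. \<exists>V\<in>Ug A \<beta>.
        \<forall>u11 u12 u21 u22. ((u11, u12), (u21, u22)) \<in> M A n n' t U V \<longrightarrow>
           u11 = u12 \<longrightarrow> (u21, u22) \<in> W)"
    proof (intro allI impI ballI)
      fix n n' t W assume "is_term A (n + n') t" "W \<in> Ug A (Ctilde_con A \<alpha> \<beta>)"
      then show "\<exists>U\<in>Ug A \<alpha>. \<exists>V\<in>Ug A \<beta>.
        \<forall>u11 u12 u21 u22. ((u11, u12), (u21, u22)) \<in> M A n n' t U V \<longrightarrow>
           u11 = u12 \<longrightarrow> (u21, u22) \<in> W"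
        \<comment> \<open>The same choice of generators as witnesses; the premise
          \<open>u11 = u12\<close> calls for no entourage \<open>W'\<close>.\<close>
        using Ct(2) by (intro bexI[OF _ Ug_self] assms) (auto simp: Ug_def)
    qed
  next
    fix \<W> assume \<W>: "\<W> \<in> Unif A" and
      P: "\<forall>n n' t. is_term A (n + n') t \<longrightarrow>
        (\<forall>W\<in>\<W>. \<exists>U\<in>Ug A \<alpha>. \<exists>V\<in>Ug A \<beta>.
          \<forall>u11 u12 u21 u22. ((u11, u12), (u21, u22)) \<in> M A n n' t U V \<longrightarrow>
             u11 = u12 \<longrightarrow> (u21, u22) \<in> W)"
    show "Ctilde_con A \<alpha> \<beta> \<subseteq> \<Inter>\<W>"
    proof (rule Ct(3)[OF Inter_Unif_in_Con[OF \<W>]], intro allI impI InterI)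
      fix n n' t u11 u12 u21 u22 W
      assume "is_term A (n + n') t" and M: "((u11, u12), u21, u22) \<in> M A n n' t \<alpha> \<beta>"
        and u: "u11 = u12" and "W \<in> \<W>"
      with P obtain U V where "U \<in> Ug A \<alpha>" "V \<in> Ug A \<beta>"
        and "\<forall>u11 u12 u21 u22. ((u11, u12), (u21, u22)) \<in> M A n n' t U V \<longrightarrow>
               u11 = u12 \<longrightarrow> (u21, u22) \<in> W"
        by blast
      \<comment> \<open>Here the equality of the first row carries over unchanged, and only the
        matrix has to be moved from \<open>\<alpha>\<close>, \<open>\<beta>\<close> to
        \<open>U\<close>, \<open>V\<close>.\<close>
      with M_Ug M u show "(u21, u22) \<in> W" by blast
    qed
  qed
qed

end
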